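(* Let $w_1,\dots,w_N>0$ be constant particle weights and $W=\mathrm{diag}(w_1,\dots,w_N)\otimes I_d$. Let $\overline{\nabla E_L^\varepsilon}$ be a discrete gradient of $\nabla E_L^\varepsilon$ and let $\Delta t$ be the time step. The discrete gradient scheme $$\frac{\boldsymbol X^{n+1}-\boldsymbol X^n}{\Delta t}=-W^{-1}\mathcal{A}\Big(\frac{\boldsymbol X^{n+1}+\boldsymbol X^n}{2}\Big)W^{-1}\,\overline{\nabla E_L^\varepsilon}(\boldsymbol X^{n+1},\boldsymbol X^n)$$ preserves the dissipative quantity $E_L^\varepsilon(\boldsymbol X)$ and the conservative quantities $\boldsymbol P$ and $K$; that is, successive solutions $\boldsymbol X^n,\boldsymbol X^{n+1}$ satisfy $$E_L^\varepsilon(\boldsymbol X^{n+1})\le E_L^\varepsilon(\boldsymbol X^n),\qquad \boldsymbol P(\boldsymbol X^{n+1})=\boldsymbol P(\boldsymbol X^n),\qquad K(\boldsymbol X^{n+1})=K(\boldsymbol X^n).$$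
   Context: Write $\boldsymbol X=(\boldsymbol x_1,\dots,\boldsymbol x_N)\in\mathbb{R}^{dN}$, $\boldsymbol x_p\in\mathbb{R}^d$. Momentum: $\boldsymbol P(\boldsymbol X)=\sum_{p=1}^N w_p\boldsymbol x_p\in\mathbb{R}^d$. Kinetic energy: $K(\boldsymbol X)=\frac12\sum_{p=1}^N w_p|\boldsymbol x_p|^2$. The regularized energy is $$E_L^\varepsilon(\boldsymbol X)=\int_{\mathbb{R}^d}H\Big(\sum_{p=1}^N w_p\varphi_\varepsilon(\boldsymbol x-\boldsymbol x_p)\Big)d\boldsymbol x,\qquad H(y)=y\log y,$$ where $\varphi_\varepsilon$ is a mollifier function on $\mathbb{R}^d$ with parameter $\varepsilon$ (often chosen as the Gaussian $(2\pi\varepsilon)^{-d/2}e^{-|\boldsymbol x|^2/(2\varepsilon)}$). $A$ is the $d\times d$ symmetric positive semi-definite matrix with entries $a_{ij}(\boldsymbol x)=C|\boldsymbol x|^\gamma(|\boldsymbol x|^2\delta_{ij}-x_ix_j)$, where $C$ is a constant and $-d\le\gamma\le1$. $\mathcal{A}(\boldsymbol X)$ is the $dN\times dN$ matrix with $d\times d$ blocks, for $i,j=1,\dots,N$, $$[\mathcal{A}(\boldsymbol X)]_{ij}=\begin{cases}w_i\sum_{k\ne i}w_kA(\boldsymbol x_i-\boldsymbol x_k),&i=j,\\-w_iw_jA(\boldsymbol x_i-\boldsymbol x_j),&i\ne j.\end{cases}$$ A discrete gradient of $\nabla E$, for $E:\mathbb{R}^k\to\mathbb{R}$, is a map $\overline{\nabla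 E}:\mathbb{R}^k\times\mathbb{R}^k\to\mathbb{R}^k$ with $\overline{\nabla E}(\boldsymbol Y,\boldsymbol X)^T(\boldsymbol Y-\boldsymbol X)=E(\boldsymbol Y)-E(\boldsymbol X)$ for all $\boldsymbol X,\boldsymbol Y\in\mathbb{R}^k$. *)

theory Defs
  imports "HOL-Analysis.Analysis"
begin

text \<open>
  The number of particles is \<open>CARD('n)\<close> and the dimension is \<open>CARD('d)\<close>.  The phase space of
  dimension \<open>d N\<close> is \<open>real ^ ('n \<times> 'd)\<close>; coordinate \<open>(p, k)\<close> is the \<open>k\<close>-th component of
  particle \<open>p\<close>, so matrices on it have blocks indexed by \<open>'n\<close> of size \<open>CARD('d)\<close>.
\<close>

definition particle :: "real ^ ('n::finite \<times> 'd::finite) \<Rightarrow> 'n \<Rightarrow> real ^ 'd" where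
  "particle X p = (\<chi> k. X $ (p, k))"

definition momentum :: "real ^ 'n \<Rightarrow> real ^ ('n::finite \<times> 'd::finite) \<Rightarrow> real ^ 'd" where
  "momentum w X = (\<Sum>p\<in>UNIV. w $ p *\<^sub>R particle X p)"

definition kinetic_energy :: "real ^ 'n \<Rightarrow> real ^ ('n::finite \<times> 'd::finite) \<Rightarrow> real" where
  "kinetic_energy w X = 1 / 2 * (\<Sum>p\<in>UNIV. w $ p * (norm (particle X p))\<^sup>2)"

fun continuously_differentiable :: "nat \<Rightarrow> ('a::euclidean_space \<Rightarrow> real) \<Rightarrow> bool" where
  "continuously_differentiable 0 f \<longleftrightarrow> continuous_on UNIV f"
| "continuously_differentiable (Suc k) f \<longleftrightarrow>
     (\<forall>x. f differentiable (at x)) \<and>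
     (\<forall>b\<in>Basis. continuously_differentiable k (\<lambda>x. frechet_derivative f (at x) b))"

text \<open>
  Mollifiers need not have compact support and no particular scaling in \<open>\<epsilon>\<close> is prescribed, so that
  the Gaussian of variance \<open>\<epsilon>\<close> is included along with the compactly supported kernels
  \<open>\<epsilon> powr - d * \<phi> (x / \<epsilon>)\<close>.
\<close>

definition mollifier :: "(real \<Rightarrow> real ^ 'd::finite \<Rightarrow> real) \<Rightarrow> bool" where
  "mollifier \<phi> \<longleftrightarrow>
     (\<forall>\<epsilon>>0. (\<forall>k. continuously_differentiable k (\<phi> \<epsilon>)) \<and> (\<forall>x. 0 \<le> \<phi> \<epsilon> x) \<and>
        integrable lborel (\<phi> \<epsilon>) \<and> (LINT x|lborel. \<phi> \<epsilon> x) = 1) \<and>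
     (\<forall>\<delta>>0. ((\<lambda>\<epsilon>. LINT x:{x. \<delta> \<le> norm x}|lborel. \<phi> \<epsilon> x) \<longlongrightarrow> 0) (at_right 0))"

text \<open>Since \<open>ln 0 = 0\<close>, the usual convention \<open>0 log 0 = 0\<close> holds.\<close>

definition entropy_density :: "real \<Rightarrow> real" where
  "entropy_density y = y * ln y"

definition regularized_energy ::
    "(real \<Rightarrow> real ^ 'd \<Rightarrow> real) \<Rightarrow> real \<Rightarrow> real ^ 'n \<Rightarrow> real ^ ('n::finite \<times> 'd::finite) \<Rightarrow> real" where
  "regularized_energy \<phi> \<epsilon> w X =
     (LINT x|lborel. entropy_density (\<Sum>p\<in>UNIV. w $ p * \<phi> \<epsilon> (x - particle X p)))"

text \<open>
  At \<open>x = 0\<close> the factor \<open>norm x powr \<gamma>\<close> may be singular; here the kernel vanishes at \<open>0\<close>, which for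
  \<open>\<gamma> > - 2\<close> is its continuous extension.
\<close>

definition collision_kernel :: "real \<Rightarrow> real \<Rightarrow> real ^ 'd::finite \<Rightarrow> real ^ 'd ^ 'd" where
  "collision_kernel C \<gamma> x =
     (\<chi> i j. C * norm x powr \<gamma> * ((norm x)\<^sup>2 * (if i = j then 1 else 0) - x $ i * x $ j))"

definition collision_block ::
    "real \<Rightarrow> real \<Rightarrow> real ^ 'n \<Rightarrow> real ^ ('n::finite \<times> 'd::finite) \<Rightarrow> 'n \<Rightarrow> 'n \<Rightarrow> real ^ 'd ^ 'd" where
  "collision_block C \<gamma> w X i j =
     (if i = j
      then w $ i *\<^sub>R (\<Sum>k\<in>UNIV - {i}. w $ k *\<^sub>R collision_kernel C \<gamma> (particle X i - particle X k))
      else - ((w $ i * w $ j) *\<^sub>R collision_kernel C \<gamma> (particle X i - particle X j)))"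

definition collision_matrix ::
    "real \<Rightarrow> real \<Rightarrow> real ^ 'n \<Rightarrow> real ^ ('n::finite \<times> 'd::finite) \<Rightarrow> real ^ ('n \<times> 'd) ^ ('n \<times> 'd)" where
  "collision_matrix C \<gamma> w X =
     (\<chi> r c. collision_block C \<gamma> w X (fst r) (fst c) $ snd r $ snd c)"

definition diag_matrix :: "real ^ 'n::finite \<Rightarrow> real ^ 'n ^ 'n" where
  "diag_matrix w = (\<chi> i j. if i = j then w $ i else 0)"

definition kronecker_product ::
    "real ^ 'n::finite ^ 'n \<Rightarrow> real ^ 'd::finite ^ 'd \<Rightarrow> real ^ ('n \<times> 'd) ^ ('n \<times> 'd)" where
  "kronecker_product M B = (\<chi> r c. M $ fst r $ fst c * B $ snd r $ snd c)"

definition weight_matrix :: "real ^ 'n::finite \<Rightarrow> real ^ ('n \<times> 'd::finite) ^ ('n \<times> 'd)" where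
  "weight_matrix w = kronecker_product (diag_matrix w) (mat 1)"

definition discrete_gradient ::
    "(real ^ 'k \<Rightarrow> real) \<Rightarrow> (real ^ 'k \<Rightarrow> real ^ 'k \<Rightarrow> real ^ 'k::finite) \<Rightarrow> bool" where
  "discrete_gradient E G \<longleftrightarrow> (\<forall>X Y. G Y X \<bullet> (Y - X) = E Y - E X)"

end

theory Submission
  imports Defs
begin

text \<open>
  Writing \<open>x\<^sub>p, y\<^sub>p, z\<^sub>p\<close> for the particles of \<open>X, Y, Z\<close>, the quadratic form of the collision matrix is
  \<open>Z \<bullet> \<A>(X) Y = 1/2 \<Sum>\<^sub>i\<^sub>k w\<^sub>i w\<^sub>k (z\<^sub>i - z\<^sub>k) \<bullet> A(x\<^sub>i - x\<^sub>k) (y\<^sub>i - y\<^sub>k)\<close>.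
  It is nonnegative for \<open>Z = Y\<close> because \<open>A(x)\<close> is positive semi-definite, and it vanishes both for
  \<open>Z\<close> constant over the particles and for \<open>Z = X\<close>, because \<open>A(x) x = 0\<close>. Pairing the scheme with
  the discrete gradient, with \<open>W (e, \<dots>, e)\<close> and with \<open>W\<close> times the midpoint yields
  the three assertions.
\<close>

lemma inner_particles: "X \<bullet> Y = (\<Sum>p\<in>UNIV. particle X p \<bullet> particle Y p)"
  by (simp add: particle_def inner_vec_def sum.cartesian_product case_prod_beta flip: UNIV_Times_UNIV)

lemma particle_add: "particle (X + Y) p = particle X p + particle Y p"
  and particle_diff: "particle (X - Y) p = particle X p - particle Y p"
  and particle_scaleR: "particle (c *\<^sub>R X) p = c *\<^sub>R particle X p"
  by (simp_all add: particle_def vec_eq_iff)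

lemma particle_eqI: "(\<And>p. particle X p = particle Y p) \<Longrightarrow> X = Y"
  by (simp add: particle_def vec_eq_iff)

text \<open>The vector \<open>(norm x)\<^sup>2 *\<^sub>R y - (x \<bullet> y) *\<^sub>R x\<close> is
  \<open>(norm x)\<^sup>2\<close> times the projection of \<open>y\<close> onto the orthogonal
  complement of \<open>x\<close>. This coordinate-free form makes orthogonality to \<open>x\<close>
  and semi-definiteness immediate.\<close>

lemma collision_kernel_mult:
  "collision_kernel C \<gamma> x *v y = (C * norm x powr \<gamma>) *\<^sub>R ((norm x)\<^sup>2 *\<^sub>R y - (x \<bullet> y) *\<^sub>R x)"
proof -
  have "(\<Sum>j\<in>UNIV. C * norm x powr \<gamma> * ((norm x)\<^sup>2 * (if i = j then 1 else 0) - x $ i * x $ j) * y $ j) =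
      (\<Sum>j\<in>UNIV. C * norm x powr \<gamma> *
        ((if i = j then (norm x)\<^sup>2 * y $ j else 0) - x $ j * y $ j * x $ i))" for i
    by (intro sum.cong refl) (simp add: algebra_simps)
  also have "\<dots> i = C * norm x powr \<gamma> *
      ((norm x)\<^sup>2 * y $ i - (\<Sum>j\<in>UNIV. x $ j * y $ j) * x $ i)" for i
    by (simp only: sum_subtractf flip: sum_distrib_left sum_distrib_right) simp
  finally show ?thesis
    by (simp add: vec_eq_iff collision_kernel_def matrix_vector_mult_def inner_vec_def)
qed

lemma collision_kernel_minus: "collision_kernel C \<gamma> (- x) = collision_kernel C \<gamma> x"
  by (simp add: collision_kernel_def)

lemma inner_collision_kernel_self: "x \<bullet> (collision_kernel C \<gamma> x *v y) = 0"
  by (simp add: collision_kernel_mult inner_diff_right power2_norm_eq_inner)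

text \<open>The quadratic form is a nonnegative factor times the Cauchy-Schwarz defect of
  \<open>x\<close> and \<open>y\<close>.\<close>

lemma collision_kernel_nonneg:
  assumes "0 \<le> C"
  shows "0 \<le> y \<bullet> (collision_kernel C \<gamma> x *v y)"
proof -
  have "(x \<bullet> y) * (x \<bullet> y) \<le> (norm x)\<^sup>2 * (y \<bullet> y)"
    using Cauchy_Schwarz_ineq[of x y] by (simp add: power2_eq_square dot_square_norm)
  then show ?thesis
    using assms by (simp add: collision_kernel_mult inner_diff_right inner_commute)
qed

lemma matrix_vector_mult_minus_left:
  fixes A :: "real ^ 'n ^ 'm"
  shows "(- A) *v v = - (A *v v)"
  by (simp add: vec_eq_iff matrix_vector_mult_def sum_negf)

lemma matrix_sum_vector_mult:
  fixes M :: "'a \<Rightarrow> real ^ 'n ^ 'm"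
  shows "sum M S *v v = (\<Sum>k\<in>S. M k *v v)"
  by (induction S rule: infinite_finite_induct) (simp_all add: matrix_vector_mult_add_rdistrib)

text \<open>The diagonal block is minus the sum of the off-diagonal blocks in its row, so only
  differences of particles of \<open>Y\<close> enter.\<close>

lemma particle_collision_matrix_mult:
  "particle (collision_matrix C \<gamma> w X *v Y) i =
    (\<Sum>k\<in>UNIV. (w $ i * w $ k) *\<^sub>R
      (collision_kernel C \<gamma> (particle X i - particle X k) *v (particle Y i - particle Y k)))"
proof -
  let ?B = "collision_block C \<gamma> w X i"
  let ?A = "\<lambda>k. collision_kernel C \<gamma> (particle X i - particle X k)"
  have "particle (collision_matrix C \<gamma> w X *v Y) i = (\<Sum>k\<in>UNIV. ?B k *v particle Y k)"
    by (simp add: particle_def vec_eq_iff collision_matrix_def matrix_vector_mult_def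
        sum.cartesian_product flip: UNIV_Times_UNIV) (simp add: case_prod_beta)
  also have "\<dots> = ?B i *v particle Y i + (\<Sum>k\<in>UNIV - {i}. ?B k *v particle Y k)"
    by (simp add: sum.remove)
  also have "?B i *v particle Y i =
      (\<Sum>k\<in>UNIV - {i}. (w $ i * w $ k) *\<^sub>R (?A k *v particle Y i))"
    by (simp add: collision_block_def matrix_sum_vector_mult
        scaleR_sum_right flip: scaleR_matrix_vector_assoc)
  also have "(\<Sum>k\<in>UNIV - {i}. ?B k *v particle Y k) =
      - (\<Sum>k\<in>UNIV - {i}. (w $ i * w $ k) *\<^sub>R (?A k *v particle Y k))"
    unfolding sum_negf[symmetric]
    by (intro sum.cong refl) (auto simp: collision_block_def matrix_vector_mult_minus_left
        simp flip: scaleR_matrix_vector_assoc)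
  also have "(\<Sum>k\<in>UNIV - {i}. (w $ i * w $ k) *\<^sub>R (?A k *v particle Y i)) + \<dots> =
      (\<Sum>k\<in>UNIV - {i}. (w $ i * w $ k) *\<^sub>R (?A k *v (particle Y i - particle Y k)))"
    by (simp add: sum_subtractf matrix_vector_mult_diff_distrib scaleR_diff_right)
  \<comment> \<open>The term \<open>k = i\<close> vanishes since it applies the kernel to
    \<open>particle Y i - particle Y i\<close>; summing over all \<open>k\<close> allows
    \<open>i\<close> and \<open>k\<close> to be exchanged later.\<close>
  also have "\<dots> = (\<Sum>k\<in>UNIV. (w $ i * w $ k) *\<^sub>R (?A k *v (particle Y i - particle Y k)))"
    by (intro sum.mono_neutral_left) auto
  finally show ?thesis .
qed

text \<open>Symmetrization: the kernel is even, so \<open>?f\<close> is antisymmetric in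
  \<open>i\<close> and \<open>k\<close>, and averaging the double sum with its transpose gives the
  differences of \<open>Z\<close>.\<close>

lemma inner_collision_matrix:
  "Z \<bullet> (collision_matrix C \<gamma> w X *v Y) =
    1 / 2 * (\<Sum>i\<in>UNIV. \<Sum>k\<in>UNIV. w $ i * w $ k * ((particle Z i - particle Z k) \<bullet>
      (collision_kernel C \<gamma> (particle X i - particle X k) *v (particle Y i - particle Y k))))"
  (is "?l = 1 / 2 * (\<Sum>i\<in>UNIV. \<Sum>k\<in>UNIV. w $ i * w $ k * (_ \<bullet> ?f i k))")
proof -
  have anti: "?f k i = - ?f i k" for i k
    using collision_kernel_minus[of C \<gamma> "particle X i - particle X k"]
    by (simp add: collision_kernel_mult norm_minus_commute algebra_simps)
  let ?g = "\<lambda>i k. w $ i * w $ k * (particle Z i \<bullet> ?f i k)"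
  have l: "?l = (\<Sum>i\<in>UNIV. \<Sum>k\<in>UNIV. ?g i k)"
    by (simp add: inner_particles particle_collision_matrix_mult inner_sum_right)
  then have l': "?l = (\<Sum>i\<in>UNIV. \<Sum>k\<in>UNIV. ?g k i)"
    by (subst sum.swap) simp
  have "w $ i * w $ k * ((particle Z i - particle Z k) \<bullet> ?f i k) = ?g i k + ?g k i" for i k
    unfolding anti[of k i] by (simp add: algebra_simps)
  then have "(\<Sum>i\<in>UNIV. \<Sum>k\<in>UNIV. w $ i * w $ k * ((particle Z i - particle Z k) \<bullet> ?f i k)) =
      ?l + ?l"
    by (subst (2) l', subst l) (simp only: sum.distrib)
  then show ?thesis by simp
qed

lemma particle_weight_matrix_mult:
  fixes w :: "real ^ 'n::finite" and Y :: "real ^ ('n \<times> 'd::finite)"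
  shows "particle (weight_matrix w *v Y) p = w $ p *\<^sub>R particle Y p"
proof -
  have "weight_matrix w $ r $ c = (if c = r then w $ fst r else 0)" for r c :: "'n \<times> 'd"
    by (auto simp: weight_matrix_def kronecker_product_def diag_matrix_def mat_def prod_eq_iff)
  then show ?thesis
    by (simp add: particle_def vec_eq_iff matrix_vector_mult_def if_distrib[of "\<lambda>u. u * _"]
        cong: if_cong)
qed

lemma particle_weight_matrix_inv_mult:
  fixes w :: "real ^ 'n::finite" and Y :: "real ^ ('n \<times> 'd::finite)"
  assumes "\<And>p. w $ p \<noteq> 0"
  shows "particle (matrix_inv (weight_matrix w) *v Y) p = (1 / w $ p) *\<^sub>R particle Y p"
proof -
  let ?W = "weight_matrix w :: real ^ ('n \<times> 'd) ^ ('n \<times> 'd)"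
  let ?V = "weight_matrix (\<chi> p. 1 / w $ p) :: real ^ ('n \<times> 'd) ^ ('n \<times> 'd)"
  have "?W ** ?V = mat 1" "?V ** ?W = mat 1"
    by (simp_all add: matrix_eq particle_eqI particle_weight_matrix_mult assms
        flip: matrix_vector_mul_assoc)
  \<comment> \<open>\<open>matrix_inv\<close> is a Hilbert choice; the reciprocal weights in
    \<open>?V\<close> show that an inverse exists, so the chosen matrix is one.\<close>
  then have "?W ** matrix_inv ?W = mat 1"
    unfolding matrix_inv_def by (metis (mono_tags, lifting) someI_ex)
  then have "?W *v (matrix_inv ?W *v Y) = Y"
    by (simp add: matrix_vector_mul_assoc)
  then have "w $ p *\<^sub>R particle (matrix_inv ?W *v Y) p = particle Y p"
    by (metis particle_weight_matrix_mult)
  then show ?thesis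
    using assms[of p] by (simp add: divide_simps flip: \<open>w $ p *\<^sub>R _ = _\<close>)
qed

theorem lemma3p7:
  fixes w :: "real ^ 'n::finite"
    and \<phi> :: "real \<Rightarrow> real ^ 'd::finite \<Rightarrow> real"
    and \<epsilon> C \<gamma> \<Delta>t :: real
    and G :: "real ^ ('n \<times> 'd) \<Rightarrow> real ^ ('n \<times> 'd) \<Rightarrow> real ^ ('n \<times> 'd)"
    and X :: "nat \<Rightarrow> real ^ ('n \<times> 'd)"
    and n :: nat
  assumes "\<And>p. 0 < w $ p"
    and "mollifier \<phi>" and "0 < \<epsilon>"
    and "0 \<le> C"
    and "- real CARD('d) \<le> \<gamma>" and "\<gamma> \<le> 1"
    and "0 < \<Delta>t"
    and "discrete_gradient (regularized_energy \<phi> \<epsilon> w) G"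
    and "(1 / \<Delta>t) *\<^sub>R (X (Suc n) - X n) =
      - (matrix_inv (weight_matrix w)
           ** collision_matrix C \<gamma> w ((1 / 2) *\<^sub>R (X (Suc n) + X n))
           ** matrix_inv (weight_matrix w)) *v G (X (Suc n)) (X n)"
  shows "regularized_energy \<phi> \<epsilon> w (X (Suc n)) \<le> regularized_energy \<phi> \<epsilon> w (X n) \<and>
    momentum w (X (Suc n)) = momentum w (X n) \<and>
    kinetic_energy w (X (Suc n)) = kinetic_energy w (X n)"
proof -
  let ?W = "weight_matrix w :: real ^ ('n \<times> 'd) ^ ('n \<times> 'd)"
  define M where "M = (1 / 2) *\<^sub>R (X (Suc n) + X n)"
  define V where "V = matrix_inv ?W *v G (X (Suc n)) (X n)"
  define D where "D = collision_matrix C \<gamma> w M *v V"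
  have w0: "w $ p \<noteq> 0" for p
    using assms(1)[of p] by simp
  have "X (Suc n) - X n = \<Delta>t *\<^sub>R ((1 / \<Delta>t) *\<^sub>R (X (Suc n) - X n))"
    using assms(7) by simp
  also have "\<dots> = - (\<Delta>t *\<^sub>R (matrix_inv ?W *v D))"
    unfolding assms(9) D_def V_def M_def
    by (simp add: matrix_vector_mul_assoc matrix_mul_assoc matrix_vector_mult_minus_left)
  finally have step: "X (Suc n) - X n = - \<Delta>t *\<^sub>R (matrix_inv ?W *v D)" by simp
  have step_p: "w $ p *\<^sub>R (particle (X (Suc n)) p - particle (X n) p) = - \<Delta>t *\<^sub>R particle D p" for p
    using w0[of p] unfolding particle_diff[symmetric] step
    by (simp only: particle_scaleR particle_weight_matrix_inv_mult[OF w0]) simp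

  have "regularized_energy \<phi> \<epsilon> w (X (Suc n)) - regularized_energy \<phi> \<epsilon> w (X n) =
      G (X (Suc n)) (X n) \<bullet> (X (Suc n) - X n)"
    using assms(8) by (simp add: discrete_gradient_def)
  \<comment> \<open>The inverse weight matrix is diagonal, so it moves across the inner product from
    \<open>D\<close> to the discrete gradient.\<close>
  also have "\<dots> = - \<Delta>t * (V \<bullet> D)"
    unfolding step V_def inner_particles particle_scaleR particle_weight_matrix_inv_mult[OF w0]
    by (simp add: sum_distrib_left)
  also have "\<dots> \<le> 0"
  proof -
    have "0 \<le> V \<bullet> D"
      unfolding D_def inner_collision_matrix
      by (intro mult_nonneg_nonneg sum_nonneg collision_kernel_nonneg assms(4)
          less_imp_le[OF assms(1)]) simp
    then show ?thesis using assms(7) by simp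
  qed
  finally have energy: "regularized_energy \<phi> \<epsilon> w (X (Suc n)) \<le> regularized_energy \<phi> \<epsilon> w (X n)"
    by simp

  \<comment> \<open>It suffices to test the momentum increment against every \<open>e\<close>; in
    the end \<open>e\<close> is the increment itself.\<close>
  have "e \<bullet> (momentum w (X (Suc n)) - momentum w (X n)) = 0" for e :: "real ^ 'd"
  proof -
    define Z :: "real ^ ('n \<times> 'd)" where "Z = (\<chi> r. e $ snd r)"
    have Z: "particle Z p = e" for p
      by (simp add: Z_def particle_def vec_eq_iff)
    have "e \<bullet> (momentum w (X (Suc n)) - momentum w (X n)) = - \<Delta>t * (Z \<bullet> D)"
      unfolding momentum_def sum_subtractf[symmetric] scaleR_diff_right[symmetric] step_p
      by (simp add: inner_particles Z inner_sum_right sum_distrib_left)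
    \<comment> \<open>All particles of \<open>Z\<close> equal \<open>e\<close>, so every difference
      in the symmetrized form is zero.\<close>
    also have "Z \<bullet> D = 0"
      by (simp add: D_def inner_collision_matrix Z)
    finally show ?thesis by simp
  qed
  then have momentum: "momentum w (X (Suc n)) = momentum w (X n)"
    using inner_eq_zero_iff by (metis right_minus_eq)

  \<comment> \<open>A difference of squares is the sum paired with the difference, and the sum is
    twice the midpoint \<open>M\<close>.\<close>
  have "w $ p * (norm (particle (X (Suc n)) p))\<^sup>2 - w $ p * (norm (particle (X n) p))\<^sup>2 =
      2 * (particle M p \<bullet> (w $ p *\<^sub>R (particle (X (Suc n)) p - particle (X n) p)))" for p
    by (simp add: M_def particle_add particle_scaleR power2_norm_eq_inner inner_commute algebra_simps)
  then have "kinetic_energy w (X (Suc n)) - kinetic_energy w (X n) = - \<Delta>t * (M \<bullet> D)"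
    unfolding kinetic_energy_def right_diff_distrib[symmetric] sum_subtractf[symmetric] step_p
    by (simp add: inner_particles sum_distrib_left)
  \<comment> \<open>The collision matrix in \<open>D\<close> is evaluated at this same
    \<open>M\<close>, so each summand pairs a difference \<open>x\<close> with a vector in the range
    of the kernel at \<open>x\<close>, which is orthogonal to \<open>x\<close>.\<close>
  also have "M \<bullet> D = 0"
    by (simp add: D_def inner_collision_matrix inner_collision_kernel_self)
  finally have "kinetic_energy w (X (Suc n)) = kinetic_energy w (X n)" by simp
  with energy momentum show ?thesis by blast
qed

end
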